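(* Let $u$ be the word over $\{0,1,2\}$ of length $732$ obtained by concatenating, in order, the following eleven strings of digits (each digit being one letter): 0000000100100000100100000001001100000001001000001001000000010020000 0100100100000001001000001001000001001000000010010010000000100100000 1001000001001000000010010010000000100100000100100000100100000001001 0010000000100100000100100000100100000001001001000000010010000010010 0000100100000001001001000000010010000010010000010010000000100100100 0000010010000010010000010010000000100100100000001001000001001000001 0010110000000100100000100100000001002000001001001000000010010000010 0100000100100000001001001000000010010000010010000010010000000100100 1000000010010000010010000010010000000100100100000001001000001001000 0010010001000100010001000100010001101000000010010000010010000000101 00010001000100010001000100010100000001001000001001000000010100. Let $\varphi$ be the $733$-uniform morphism on $\mathbb{Z}_{\geq 0}$ defined by $\varphi(n) = u\,(n + 2)$ for all $n \in \mathbb{Z}_{\geq 0}$. Then $\textbf{w}_{8/5} = \varphi^\infty(0)$.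
   Context: Words are finite or infinite sequences of letters, indexed from position $0$; a factor is a contiguous subword. Let $a, b$ be relatively prime positive integers. For a nonempty word $v$ whose length is divisible by $b$, define $v^{a/b} = v^{\lfloor a/b \rfloor} v_0 v_1 \cdots v_{t-1}$, where $t = |v|\,(a/b - \lfloor a/b\rfloor)$; such a word is called an $\frac{a}{b}$-power. A word is $\frac{a}{b}$-power-free if none of its factors is an $\frac{a}{b}$-power. For $\frac{a}{b} > 1$, $\textbf{w}_{a/b}$ denotes the lexicographically least infinite word over the alphabet $\mathbb{Z}_{\geq 0}$ that is $\frac{a}{b}$-power-free. A morphism $\varphi$ on an alphabet $\Sigma$ is a map $\Sigma \to \Sigma^*$, extended to words by concatenation; it is $k$-uniform if $|\varphi(c)| = k$ for every letter $c$. If $\varphi(c)$ begins with $c$, $\varphi^\infty(c)$ denotes the infinite fixed point of $\varphi$ beginning with $c$. *)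

theory Defs
  imports "HOL-Library.Omega_Words_Fun" "HOL-Library.Fun_Lexorder"
begin

text \<open>
  Finite words are lists, and infinite words are functions on \<open>nat\<close> (type \<open>'a word\<close>, where
  \<open>x [i \<rightarrow> j]\<close> is the factor of \<open>x\<close> occupying positions \<open>i, ..., j - 1\<close>).  An exponent \<open>a/b\<close> is
  given by its numerator \<open>a\<close> and denominator \<open>b\<close>, two relatively prime positive integers.
\<close>

section \<open>Fractional powers\<close>

text \<open>
  \<open>\<lfloor>a/b\<rfloor> = a div b\<close> and \<open>a/b - \<lfloor>a/b\<rfloor> = (a mod b)/b\<close>; as \<open>b\<close> divides \<open>|v|\<close>, the division by \<open>b\<close>
  in the length of the partial repetition is exact.
\<close>

definition frac_power :: "nat \<Rightarrow> nat \<Rightarrow> 'a list \<Rightarrow> 'a list" where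
  "frac_power a b v = concat (replicate (a div b) v) @ take (length v * (a mod b) div b) v"

definition is_frac_power :: "nat \<Rightarrow> nat \<Rightarrow> 'a list \<Rightarrow> bool" where
  "is_frac_power a b w \<longleftrightarrow> (\<exists>v. v \<noteq> [] \<and> b dvd length v \<and> w = frac_power a b v)"

definition power_free :: "nat \<Rightarrow> nat \<Rightarrow> 'a word \<Rightarrow> bool" where
  "power_free a b x \<longleftrightarrow> (\<forall>i j. i \<le> j \<longrightarrow> \<not> is_frac_power a b (x [i \<rightarrow> j]))"

definition is_lex_least_power_free :: "nat \<Rightarrow> nat \<Rightarrow> nat word \<Rightarrow> bool" where
  "is_lex_least_power_free a b x \<longleftrightarrow>
     power_free a b x \<and> (\<forall>y. power_free a b y \<and> y \<noteq> x \<longrightarrow> less_fun x y)"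

text \<open>The description below is proper for every \<open>a/b > 1\<close>; see \<open>ex1_lex_least_power_free\<close>.\<close>

definition lex_least_power_free :: "nat \<Rightarrow> nat \<Rightarrow> nat word" where
  "lex_least_power_free a b = (THE x. is_lex_least_power_free a b x)"

lemma frac_power_split:
  assumes "0 < b" "b < a" "v \<noteq> []" "b dvd length v"
  obtains r where "frac_power a b v = v @ r" "r \<noteq> []" "set r \<subseteq> set v"
proof -
  obtain k where k: "a div b = Suc k"
    using assms(1,2) by (metis div_greater_zero_iff gr0_implies_Suc less_imp_le)
  define r where "r = concat (replicate k v) @ take (length v * (a mod b) div b) v"
  have "r \<noteq> []"
  proof (cases k)
    case 0
    then have "a div b = 1" using k by simp
    with assms(1,2) have "a mod b \<noteq> 0"
      by (metis add.right_neutral div_mult_mod_eq less_irrefl mult_1)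
    moreover have "b \<le> length v" using assms(3,4) by (simp add: dvd_imp_le)
    ultimately have "b \<le> length v * (a mod b)"
      by (metis le_trans mult_le_mono2 mult.right_neutral One_nat_def Suc_leI neq0_conv)
    then have "0 < length v * (a mod b) div b" using assms(1) by (simp add: div_greater_zero_iff)
    then show ?thesis using assms(3) by (simp add: r_def)
  next
    case (Suc m)
    then show ?thesis using assms(3) by (simp add: r_def)
  qed
  moreover have "set r \<subseteq> set v"
    by (auto simp: r_def dest: in_set_takeD split: if_splits)
  moreover have "frac_power a b v = v @ r" by (simp add: frac_power_def k r_def)
  ultimately show ?thesis using that by blast
qed

theorem ex1_lex_least_power_free:
  assumes b: "0 < b" and ab: "b < a"
  shows "\<exists>!x. is_lex_least_power_free a b x"
proof -
  define lf where "lf l \<longleftrightarrow> (\<forall>p v s. l = p @ v @ s \<longrightarrow> \<not> is_frac_power a b v)" for l :: "nat list"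
  have pow_ne: "v \<noteq> []" if "is_frac_power a b v" for v :: "nat list"
  proof -
    from that obtain v0 where "v0 \<noteq> []" "b dvd length v0" "v = frac_power a b v0"
      unfolding is_frac_power_def by blast
    then show ?thesis using frac_power_split[OF b ab] by (metis append_is_Nil_conv)
  qed
  have lf_Nil: "lf []" unfolding lf_def using pow_ne by auto
  have ext: "\<exists>c. lf (l @ [c])" if l: "lf l" for l
  proof -
    obtain c where c: "c \<notin> set l" using ex_new_if_finite[of "set l"] infinite_UNIV_nat by blast
    have "lf (l @ [c])" unfolding lf_def
    proof (intro allI impI notI)
      fix p v s
      assume eq: "l @ [c] = p @ v @ s" and pw: "is_frac_power a b v"
      show False
      proof (cases s rule: rev_cases)
        case (snoc s' d)
        then have "l = p @ v @ s'" using eq by simp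
        then show False using l pw unfolding lf_def by blast
      next
        case Nil
        obtain v0 where v0: "v0 \<noteq> []" "b dvd length v0" "v = frac_power a b v0"
          using pw unfolding is_frac_power_def by blast
        obtain r where r: "v = v0 @ r" "r \<noteq> []" "set r \<subseteq> set v0"
          using frac_power_split[OF b ab v0(1,2)] v0(3) by metis
        obtain r' d where r': "r = r' @ [d]" using r(2) by (cases r rule: rev_cases) auto
        from eq Nil r(1) r' have "l = p @ v0 @ r'" "c = d" by simp_all
        moreover have "d \<in> set v0" using r(3) r' by simp
        ultimately show False using c by simp
      qed
    qed
    then show ?thesis by blast
  qed
  define g where "g n = ((\<lambda>l. l @ [LEAST c. lf (l @ [c])]) ^^ n) []" for n
  define w where "w n = (LEAST c. lf (g n @ [c]))" for n
  have g0: "g 0 = []" and gS: "g (Suc n) = g n @ [w n]" for n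
    by (simp_all add: g_def w_def)
  have gpre: "g n = w [0 \<rightarrow> n]" for n
    by (induction n) (simp_all add: g0 gS subsequence_def)
  have glf: "lf (g n)" for n
  proof (induction n)
    case 0
    show ?case by (simp add: g0 lf_Nil)
  next
    case (Suc n)
    show ?case unfolding gS w_def by (rule LeastI_ex[OF ext[OF Suc]])
  qed
  have free_iff: "power_free a b x \<longleftrightarrow> (\<forall>n. lf (x [0 \<rightarrow> n]))" for x :: "nat word"
  proof
    assume f: "power_free a b x"
    show "\<forall>n. lf (x [0 \<rightarrow> n])" unfolding lf_def
    proof (intro allI impI notI)
      fix n p v s
      assume eq: "x [0 \<rightarrow> n] = p @ v @ s" and pw: "is_frac_power a b v"
      let ?i = "length p" and ?j = "length p + length v"
      have "length (x [0 \<rightarrow> n]) = length (p @ v @ s)" using eq by simp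
      then have len: "n = length p + length v + length s" by (simp add: subsequence_def)
      have "v = take (length v) (drop ?i (x [0 \<rightarrow> n]))" by (simp add: eq)
      also have "\<dots> = x [?i \<rightarrow> ?j]"
        using len by (simp add: subsequence_def take_map drop_map)
      finally show False using f pw unfolding power_free_def by (metis le_add1)
    qed
  next
    assume l: "\<forall>n. lf (x [0 \<rightarrow> n])"
    show "power_free a b x" unfolding power_free_def
    proof (intro allI impI)
      fix i j :: nat
      assume "i \<le> j"
      then have "x [0 \<rightarrow> j] = x [0 \<rightarrow> i] @ x [i \<rightarrow> j] @ []"
        using subsequence_append[of x i "j - i"] by simp
      then show "\<not> is_frac_power a b (x [i \<rightarrow> j])" using l unfolding lf_def by blast
    qed
  qed
  have wl: "is_lex_least_power_free a b w" unfolding is_lex_least_power_free_def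
  proof (intro conjI allI impI)
    show "power_free a b w" using glf gpre free_iff by simp
    fix y
    assume y: "power_free a b y \<and> y \<noteq> w"
    then obtain m where "y m \<noteq> w m" by blast
    define n where "n = (LEAST m. y m \<noteq> w m)"
    have n: "y n \<noteq> w n" unfolding n_def by (rule LeastI) fact
    have lt: "y i = w i" if "i < n" for i
      using not_less_Least that unfolding n_def by blast
    have "y [0 \<rightarrow> n] = g n" unfolding gpre subsequence_def using lt by auto
    then have "y [0 \<rightarrow> Suc n] = g n @ [y n]" by (simp add: subsequence_def)
    moreover have "lf (y [0 \<rightarrow> Suc n])" using y free_iff by blast
    ultimately have "lf (g n @ [y n])" by simp
    then have "w n \<le> y n" unfolding w_def by (rule Least_le)
    then show "less_fun w y" unfolding less_fun_def using n lt by (intro exI[of _ n]) auto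
  qed
  show ?thesis
  proof (rule ex1I[of _ w])
    show "is_lex_least_power_free a b w" by (fact wl)
    fix x
    assume "is_lex_least_power_free a b x"
    then show "x = w" using wl less_fun_asym unfolding is_lex_least_power_free_def by blast
  qed
qed

section \<open>Morphisms and their fixed points\<close>

text \<open>A morphism is given by its values on letters.\<close>

definition morphism_word :: "('a \<Rightarrow> 'b list) \<Rightarrow> 'a list \<Rightarrow> 'b list" where
  "morphism_word \<phi> w = concat (map \<phi> w)"

definition uniform_morphism :: "nat \<Rightarrow> ('a \<Rightarrow> 'b list) \<Rightarrow> bool" where
  "uniform_morphism k \<phi> \<longleftrightarrow> (\<forall>c. length (\<phi> c) = k)"

text \<open>
  \<open>y = \<phi>(x)\<close> for infinite words: \<open>y\<close> is the infinite word having all the words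
  \<open>\<phi>(x\<^sub>0) \<phi>(x\<^sub>1) \<dots> \<phi>(x\<^sub>n\<^sub>-\<^sub>1)\<close> as prefixes.  Their lengths are required to be unbounded, since
  otherwise \<open>\<phi>(x)\<close> is a finite word.
\<close>

definition is_morphism_image :: "('a \<Rightarrow> 'b list) \<Rightarrow> 'a word \<Rightarrow> 'b word \<Rightarrow> bool" where
  "is_morphism_image \<phi> x y \<longleftrightarrow>
     (\<forall>n. y [0 \<rightarrow> length (morphism_word \<phi> (x [0 \<rightarrow> n]))] = morphism_word \<phi> (x [0 \<rightarrow> n])) \<and>
     (\<forall>m. \<exists>n. m \<le> length (morphism_word \<phi> (x [0 \<rightarrow> n])))"

text \<open>
  The word \<open>\<phi>\<^sup>\<infinity>(c)\<close>.  For a \<open>k\<close>-uniform \<open>\<phi>\<close> with \<open>k \<ge> 2\<close> such that \<open>\<phi>(c)\<close> begins with \<open>c\<close>, the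
  description is proper; see \<open>ex1_fixed_point\<close>.
\<close>

definition morphism_fixed_point :: "('a \<Rightarrow> 'a list) \<Rightarrow> 'a \<Rightarrow> 'a word" where
  "morphism_fixed_point \<phi> c = (THE x. x 0 = c \<and> is_morphism_image \<phi> x x)"

theorem ex1_fixed_point:
  fixes \<phi> :: "'a \<Rightarrow> 'a list"
  assumes unif: "uniform_morphism k \<phi>" and k: "2 \<le> k" and hd: "hd (\<phi> c) = c"
  shows "\<exists>!x. x 0 = c \<and> is_morphism_image \<phi> x x"
proof -
  have len1: "length (\<phi> d) = k" for d using unif by (simp add: uniform_morphism_def)
  have len: "length (morphism_word \<phi> w) = k * length w" for w
    by (induction w) (simp_all add: morphism_word_def len1)
  have app: "morphism_word \<phi> (u @ v) = morphism_word \<phi> u @ morphism_word \<phi> v" for u v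
    by (simp add: morphism_word_def)
  define L where "L n = (morphism_word \<phi> ^^ n) [c]" for n
  have LS: "L (Suc n) = morphism_word \<phi> (L n)" for n by (simp add: L_def)
  have lenL: "length (L n) = k ^ n" for n
    by (induction n) (simp_all add: LS len, simp add: L_def)
  have "\<phi> c \<noteq> []" using len1[of c] k by auto
  then have c: "\<phi> c = c # tl (\<phi> c)" using hd by (metis list.collapse)
  have Lpre1: "\<exists>s. L (Suc n) = L n @ s" for n
  proof (induction n)
    case 0
    show ?case using c by (auto simp: L_def morphism_word_def)
  next
    case (Suc n)
    then obtain s where "L (Suc n) = L n @ s" by blast
    then have "L (Suc (Suc n)) = L (Suc n) @ morphism_word \<phi> s"
      by (metis LS app)
    then show ?case by blast
  qed
  have Lpre: "\<exists>s. L (n + m) = L n @ s" for n m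
  proof (induction m)
    case (Suc m)
    then obtain s where "L (n + m) = L n @ s" by blast
    then show ?case using Lpre1[of "n + m"] by auto
  qed simp
  have Lnth: "L n ! i = L m ! i" if "i < k ^ n" "i < k ^ m" for n m i
  proof (cases "n \<le> m")
    case True
    then show ?thesis using Lpre[of n "m - n"] that lenL by (auto simp: nth_append)
  next
    case False
    then show ?thesis using Lpre[of m "n - m"] that lenL by (auto simp: nth_append)
  qed
  have big: "n < k ^ n" for n
    using k by (simp add: power_gt_expt)
  define x where "x i = L i ! i" for i
  have xL: "x [0 \<rightarrow> k ^ n] = L n" for n
    by (rule nth_equalityI) (auto simp: subsequence_def lenL x_def intro: Lnth big)
  have x0: "x 0 = c" by (simp add: x_def L_def)
  have img: "is_morphism_image \<phi> x x" unfolding is_morphism_image_def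
  proof (intro conjI allI)
    fix n
    have le: "n \<le> k ^ n" using big[of n] by simp
    then have "x [0 \<rightarrow> n] @ x [n \<rightarrow> k ^ n] = L n"
      using subsequence_append[of x n "k ^ n - n"] xL[of n] by simp
    then have "morphism_word \<phi> (x [0 \<rightarrow> n]) @ morphism_word \<phi> (x [n \<rightarrow> k ^ n]) = x [0 \<rightarrow> k ^ Suc n]"
      by (metis LS app xL)
    then have "morphism_word \<phi> (x [0 \<rightarrow> n]) = take (k * n) (x [0 \<rightarrow> k ^ Suc n])"
      by (metis append_eq_conv_conj len subsequence_length diff_zero)
    also have "\<dots> = x [0 \<rightarrow> k * n]"
      using le by (simp add: subsequence_def take_map)
    finally show "x [0 \<rightarrow> length (morphism_word \<phi> (x [0 \<rightarrow> n]))] = morphism_word \<phi> (x [0 \<rightarrow> n])"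
      by (simp add: len)
  next
    fix m
    show "\<exists>n. m \<le> length (morphism_word \<phi> (x [0 \<rightarrow> n]))"
      using k by (intro exI[of _ m]) (simp add: len)
  qed
  have uniq: "y [0 \<rightarrow> k ^ n] = L n" if y: "y 0 = c" "is_morphism_image \<phi> y y" for y n
  proof (induction n)
    case 0
    show ?case using y(1) by (simp add: L_def subsequence_def)
  next
    case (Suc n)
    have "y [0 \<rightarrow> length (morphism_word \<phi> (L n))] = morphism_word \<phi> (L n)"
      using y(2) Suc unfolding is_morphism_image_def by metis
    then show ?case by (simp add: len lenL LS)
  qed
  show ?thesis
  proof (rule ex1I[of _ x])
    show "x 0 = c \<and> is_morphism_image \<phi> x x" using x0 img by blast
    fix y
    assume "y 0 = c \<and> is_morphism_image \<phi> y y"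
    then have "y [0 \<rightarrow> k ^ n] ! i = x [0 \<rightarrow> k ^ n] ! i" for n i using uniq xL by simp
    then have "y i = x i" for i
      using big[of i] by (metis add_0 subsequence_nth diff_zero)
    then show "y = x" by blast
  qed
qed

section \<open>The morphism\<close>

definition u :: "nat list" where
  "u = concat [
     [0,0,0,0,0,0,0,1,0,0,1,0,0,0,0,0,1,0,0,1,0,0,0,0,0,0,0,1,0,0,1,1,0,0,0,0,0,0,0,1,0,0,1,0,0,0,0,0,1,0,0,1,0,0,0,0,0,0,0,1,0,0,2,0,0,0,0],
     [0,1,0,0,1,0,0,1,0,0,0,0,0,0,0,1,0,0,1,0,0,0,0,0,1,0,0,1,0,0,0,0,0,1,0,0,1,0,0,0,0,0,0,0,1,0,0,1,0,0,1,0,0,0,0,0,0,0,1,0,0,1,0,0,0,0,0],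
     [1,0,0,1,0,0,0,0,0,1,0,0,1,0,0,0,0,0,0,0,1,0,0,1,0,0,1,0,0,0,0,0,0,0,1,0,0,1,0,0,0,0,0,1,0,0,1,0,0,0,0,0,1,0,0,1,0,0,0,0,0,0,0,1,0,0,1],
     [0,0,1,0,0,0,0,0,0,0,1,0,0,1,0,0,0,0,0,1,0,0,1,0,0,0,0,0,1,0,0,1,0,0,0,0,0,0,0,1,0,0,1,0,0,1,0,0,0,0,0,0,0,1,0,0,1,0,0,0,0,0,1,0,0,1,0],
     [0,0,0,0,1,0,0,1,0,0,0,0,0,0,0,1,0,0,1,0,0,1,0,0,0,0,0,0,0,1,0,0,1,0,0,0,0,0,1,0,0,1,0,0,0,0,0,1,0,0,1,0,0,0,0,0,0,0,1,0,0,1,0,0,1,0,0],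
     [0,0,0,0,0,1,0,0,1,0,0,0,0,0,1,0,0,1,0,0,0,0,0,1,0,0,1,0,0,0,0,0,0,0,1,0,0,1,0,0,1,0,0,0,0,0,0,0,1,0,0,1,0,0,0,0,0,1,0,0,1,0,0,0,0,0,1],
     [0,0,1,0,1,1,0,0,0,0,0,0,0,1,0,0,1,0,0,0,0,0,1,0,0,1,0,0,0,0,0,0,0,1,0,0,2,0,0,0,0,0,1,0,0,1,0,0,1,0,0,0,0,0,0,0,1,0,0,1,0,0,0,0,0,1,0],
     [0,1,0,0,0,0,0,1,0,0,1,0,0,0,0,0,0,0,1,0,0,1,0,0,1,0,0,0,0,0,0,0,1,0,0,1,0,0,0,0,0,1,0,0,1,0,0,0,0,0,1,0,0,1,0,0,0,0,0,0,0,1,0,0,1,0,0],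
     [1,0,0,0,0,0,0,0,1,0,0,1,0,0,0,0,0,1,0,0,1,0,0,0,0,0,1,0,0,1,0,0,0,0,0,0,0,1,0,0,1,0,0,1,0,0,0,0,0,0,0,1,0,0,1,0,0,0,0,0,1,0,0,1,0,0,0],
     [0,0,1,0,0,1,0,0,0,1,0,0,0,1,0,0,0,1,0,0,0,1,0,0,0,1,0,0,0,1,0,0,0,1,1,0,1,0,0,0,0,0,0,0,1,0,0,1,0,0,0,0,0,1,0,0,1,0,0,0,0,0,0,0,1,0,1],
     [0,0,0,1,0,0,0,1,0,0,0,1,0,0,0,1,0,0,0,1,0,0,0,1,0,0,0,1,0,1,0,0,0,0,0,0,0,1,0,0,1,0,0,0,0,0,1,0,0,1,0,0,0,0,0,0,0,1,0,1,0,0]]"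

definition \<phi> :: "nat \<Rightarrow> nat list" where
  "\<phi> n = u @ [n + 2]"

lemma length_u: "length u = 732"
  by (simp add: u_def)

lemma set_u: "set u = {0, 1, 2}"
  by (simp add: u_def) auto

lemma uniform_\<phi>: "uniform_morphism 733 \<phi>"
  by (simp add: uniform_morphism_def \<phi>_def length_u)

lemma hd_\<phi>: "hd (\<phi> 0) = 0"
  by (simp add: \<phi>_def u_def)

end

theory Submission
  imports Defs "HOL-Number_Theory.Pocklington"
begin

unbundle no funcset_syntax

text \<open>
  An \<open>8/5\<close>-power is a factor \<open>xyx\<close> with \<open>|x| = 3m\<close> and \<open>|y| = 2m\<close>, that is, two equal factors of
  length \<open>3m\<close> at distance \<open>5m\<close>.  Let \<open>w\<close> be the fixed point.

  Freeness: if \<open>733\<close> divides \<open>m\<close>, comparing the last letters of the images \<open>\<phi>(n)\<close> yields a power in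
  \<open>w\<close> with \<open>m/733\<close> in place of \<open>m\<close>.  Otherwise the compared positions lie in different residue
  classes modulo \<open>733\<close>, and the power of \<open>w\<close> gives one of the periodic word \<open>\<phi>(0)\<phi>(0)\<dots>\<close>.  For
  \<open>m < 245\<close> a finite check excludes this; for larger \<open>m\<close> the equality covers all residue classes,
  so that \<open>\<phi>(0)\<phi>(0)\<dots>\<close> would have a period \<open>5m\<close> prime to \<open>733\<close> and be constant.

  Minimality: lowering a letter of \<open>\<phi>(0)\<close> completes a power inside \<open>\<phi>(0)\<close> (a finite check), which
  leaves the replacement of the last letter \<open>n + 2\<close> of an image by \<open>c + 2\<close> with \<open>c < n\<close>; it
  completes the image of a power that exists by induction.
\<close>

section \<open>Powers with exponent between 1 and 2\<close>

text \<open>For \<open>b < a < 2 * b\<close>, this says that the factor of length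
  \<open>a * m\<close> at \<open>i\<close> is an \<open>a/b\<close>-power.\<close>

definition power_at :: "nat \<Rightarrow> nat \<Rightarrow> 'a word \<Rightarrow> nat \<Rightarrow> nat \<Rightarrow> bool" where
  "power_at a b x i m \<longleftrightarrow> (\<forall>k < (a - b) * m. x (i + k) = x (i + k + b * m))"

lemma frac_power_lt_2:
  assumes "b < a" "a < 2 * b" "length v = b * m"
  shows "frac_power a b v = v @ take ((a - b) * m) v"
proof -
  have "a div b = 1" using assms by (intro div_nat_eqI) auto
  moreover from this have "a mod b = a - b" by (simp add: modulo_nat_def)
  moreover have "b * m * (a - b) div b = (a - b) * m" using assms by simp
  ultimately show ?thesis using assms by (simp add: frac_power_def mult.commute)
qed

lemma is_frac_power_factor_iff:
  assumes ab: "b < a" "a < 2 * b" and "i \<le> j"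
  shows "is_frac_power a b (x [i \<rightarrow> j]) \<longleftrightarrow> (\<exists>m>0. j = i + a * m \<and> power_at a b x i m)"
proof
  assume "is_frac_power a b (x [i \<rightarrow> j])"
  then obtain v m where v: "v \<noteq> []" "length v = b * m" "x [i \<rightarrow> j] = frac_power a b v"
    unfolding is_frac_power_def dvd_def by blast
  have eq: "x [i \<rightarrow> j] = v @ take ((a - b) * m) v"
    using v frac_power_lt_2[OF ab] by simp
  have le: "(a - b) * m \<le> b * m" using ab by (intro mult_le_mono1) simp
  have sum: "b * m + (a - b) * m = a * m"
    using ab by (simp flip: distrib_right)
  have "j - i = length (v @ take ((a - b) * m) v)" by (simp flip: eq)
  then have "j - i = a * m" using v(2) le sum by simp
  moreover have "power_at a b x i m" unfolding power_at_def
  proof (intro allI impI)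
    fix k
    assume k: "k < (a - b) * m"
    have "x (i + k) = x [i \<rightarrow> j] ! k"
      using k le sum \<open>j - i = a * m\<close> by simp
    also have "\<dots> = x [i \<rightarrow> j] ! (k + b * m)"
      using k less_le_trans[OF k le] v(2) by (simp add: eq nth_append)
    also have "\<dots> = x (i + k + b * m)"
      using k le sum \<open>j - i = a * m\<close> by (simp add: add.assoc)
    finally show "x (i + k) = x (i + k + b * m)" .
  qed
  moreover have "m > 0" using v by (cases m) auto
  ultimately show "\<exists>m>0. j = i + a * m \<and> power_at a b x i m" using \<open>i \<le> j\<close> by auto
next
  assume "\<exists>m>0. j = i + a * m \<and> power_at a b x i m"
  then obtain m where m: "m > 0" "j = i + a * m" "power_at a b x i m" by blast
  define v where "v = x [i \<rightarrow> i + b * m]"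
  have le: "(a - b) * m \<le> b * m" using ab by (intro mult_le_mono1) simp
  have sum: "b * m + (a - b) * m = a * m"
    using ab by (simp flip: distrib_right)
  have len: "length v = b * m" by (simp add: v_def)
  have "x [i \<rightarrow> j] = v @ take ((a - b) * m) v"
  proof (rule nth_equalityI)
    show "length (x [i \<rightarrow> j]) = length (v @ take ((a - b) * m) v)"
      using len le sum m(2) by simp
    fix k
    assume "k < length (x [i \<rightarrow> j])"
    then have k: "k < a * m" using m(2) by simp
    show "x [i \<rightarrow> j] ! k = (v @ take ((a - b) * m) v) ! k"
    proof (cases "k < b * m")
      case True
      then show ?thesis using k m(2) by (simp add: nth_append len) (simp add: v_def)
    next
      case False
      then obtain k' where k': "k = b * m + k'" using le_Suc_ex not_less by metis
      then have "k' < (a - b) * m" using k sum by simp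
      moreover from this have "x (i + k) = x (i + k')"
        using m(3) k' unfolding power_at_def by (metis add.assoc add.commute)
      ultimately show ?thesis
        using k k' less_le_trans[OF _ le, of k'] m(2)
        by (simp add: nth_append len) (simp add: v_def)
    qed
  qed
  then have "x [i \<rightarrow> j] = frac_power a b v" using frac_power_lt_2[OF ab len] by simp
  moreover have "v \<noteq> []" using len m(1) ab by auto
  ultimately show "is_frac_power a b (x [i \<rightarrow> j])"
    unfolding is_frac_power_def using len by auto
qed

lemma power_free_iff_power_at:
  assumes "b < a" "a < 2 * b"
  shows "power_free a b x \<longleftrightarrow> (\<forall>i. \<forall>m>0. \<not> power_at a b x i m)"
  using is_frac_power_factor_iff[OF assms] unfolding power_free_def
  by (metis le_add1)

text \<open>If \<open>y n < x n\<close> at the first difference \<open>n\<close>, then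
  \<open>y\<close> agrees with \<open>x(n := y n)\<close> up to \<open>n\<close> and so contains the
  power ending there.\<close>

lemma is_lex_least_power_freeI:
  assumes ab: "b < a" "a < 2 * b" and free: "power_free a b x"
    and least: "\<And>n c. c < x n \<Longrightarrow> \<exists>m>0. \<exists>i. i + a * m = Suc n \<and> power_at a b (x(n := c)) i m"
  shows "is_lex_least_power_free a b x"
  unfolding is_lex_least_power_free_def
proof (intro conjI allI impI free)
  fix y
  assume y: "power_free a b y \<and> y \<noteq> x"
  then have ex: "\<exists>n. y n \<noteq> x n" by blast
  define n where "n = (LEAST n. y n \<noteq> x n)"
  have n: "y n \<noteq> x n" unfolding n_def by (rule LeastI_ex[OF ex])
  have agree: "y i = x i" if "i < n" for i
    using not_less_Least that unfolding n_def by blast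
  have "\<not> y n < x n"
  proof
    assume "y n < x n"
    then obtain m i where m: "m > 0" "i + a * m = Suc n" "power_at a b (x(n := y n)) i m"
      using least by blast
    have "power_at a b y i m" unfolding power_at_def
    proof (intro allI impI)
      fix k
      assume k: "k < (a - b) * m"
      have "(a - b) * m + b * m = a * m" using ab by (simp flip: distrib_right)
      then have "i + k + b * m \<le> n" using k m(2) by linarith
      then have "y (i + k) = (x(n := y n)) (i + k)"
        "y (i + k + b * m) = (x(n := y n)) (i + k + b * m)"
        using agree by (auto simp: le_less)
      then show "y (i + k) = y (i + k + b * m)" using m(3) k by (simp add: power_at_def)
    qed
    then show False using y m(1) power_free_iff_power_at[OF ab] by blast
  qed
  then show "less_fun x y" unfolding less_fun_def using n agree by (intro exI[of _ n]) auto
qed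

section \<open>The periodic word \<open>\<phi>(0)\<phi>(0)\<dots>\<close>\<close>

definition block :: "nat word" where
  "block i = \<phi> 0 ! (i mod 733)"

lemma block_mod: "block (i mod 733) = block i"
  by (simp add: block_def)

text \<open>In evaluations, indices past the block are reduced by subtraction instead of
  division.\<close>

lemma block_wrap: "733 \<le> i \<Longrightarrow> block i = block (i - 733)"
  by (simp add: block_def le_mod_geq)

lemma block_cong: "[i = j] (mod 733) \<Longrightarrow> block i = block j"
  by (simp add: block_def cong_def)

lemma block_le_2: "block i \<le> 2"
proof -
  have "block i \<in> set (\<phi> 0)"
    using uniform_\<phi> unfolding block_def uniform_morphism_def by (intro nth_mem) simp
  then show ?thesis using set_u by (auto simp: \<phi>_def)
qed

fun nth_from :: "(nat \<Rightarrow> 'a) \<Rightarrow> nat \<Rightarrow> 'a list \<Rightarrow> bool" where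
  "nth_from f i [] = True"
| "nth_from f i (x # xs) = (f i = x \<and> nth_from f (i + 1) xs)"

lemma nth_from_iff: "nth_from f i xs \<longleftrightarrow> (\<forall>k < length xs. f (i + k) = xs ! k)"
  by (induction f i xs rule: nth_from.induct) (auto simp: All_less_Suc2)

lemma nth_from_block: "nth_from block 0 (\<phi> 0)"
  using uniform_\<phi> by (simp add: nth_from_iff block_def uniform_morphism_def)

text \<open>The 733 equations \<open>block 0 = 0, ..., block 732 = 2\<close>, so that looking up a letter takes
  one rewrite step instead of a traversal of \<open>u\<close>.\<close>

lemmas block_nth [simp] =
  nth_from_block[simplified \<phi>_def u_def concat.simps append.simps nth_from.simps
    add_0 one_add_one numeral_plus_one add_num_simps]

text \<open>The simplifier turns \<open>1\<close> into \<open>Suc 0\<close>, which the equation for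
  \<open>block 1\<close> does not match.\<close>

lemma block_Suc_0 [simp]: "block (Suc 0) = 0"
  by (simp flip: One_nat_def)

text \<open>
  \<open>scan L d lo p\<close> decides whether every window of length \<open>L\<close> starting in \<open>{lo..<733}\<close> contains a
  position whose letter differs from the one \<open>d\<close> places later.  It looks for such a position
  backwards from \<open>p\<close>; one position serves all windows that contain it.
\<close>

function scan :: "nat \<Rightarrow> nat \<Rightarrow> nat \<Rightarrow> nat \<Rightarrow> bool" where
  "scan L d lo p =
     (if 733 \<le> lo then True else if p < lo then False
      else if block p = block (p + d) then (if p = lo then False else scan L d lo (p - 1))
      else scan L d (p + 1) (p + L))"
  by auto
termination
  by (relation "inv_image (less_than <*lex*> less_than) (\<lambda>(L, d, lo, p). (733 - lo, p))") auto

declare scan.simps [simp del]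

lemma scan_sound:
  assumes "scan L d lo p" "p < lo + L" "lo \<le> i" "i < 733"
  shows "\<exists>q. i \<le> q \<and> q < i + L \<and> block q \<noteq> block (q + d)"
  using assms
proof (induction L d lo p rule: scan.induct)
  case (1 L d lo p)
  have lo: "\<not> 733 \<le> lo" "\<not> p < lo"
    using "1.prems" by (auto simp: scan.simps[of L d lo p])
  show ?case
  proof (cases "block p = block (p + d)")
    case True
    then have *: "p \<noteq> lo \<and> scan L d lo (p - 1)"
      using "1.prems"(1) lo by (simp add: scan.simps[of L d lo p] split: if_splits)
    show ?thesis
      using "1.IH"(1)[OF lo] True * "1.prems" by simp
  next
    case False
    then have *: "scan L d (p + 1) (p + L)"
      using "1.prems"(1) lo by (simp add: scan.simps[of L d lo p])
    show ?thesis
    proof (cases "i \<le> p")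
      case True
      then show ?thesis using "1.prems" False by (intro exI[of _ p]) auto
    next
      case i: False
      then show ?thesis
        using "1.IH"(2)[OF lo] False * "1.prems" by simp
    qed
  qed
qed

text \<open>Ground rewrite rules for the finite checks; with the full simplifier set, the arithmetic
  procedures called on every condition dominate the cost.\<close>

lemmas eval_rules =
  block_nth block_wrap if_True if_False simp_thms rel_simps zero_neq_one one_neq_zero
  zero_le zero_less_numeral not_less_zero not_numeral_le_zero
  arith_simps numeral_One one_add_one numeral_plus_one one_plus_numeral mult_1_right
  diff_0_eq_0 diff_self_eq_0 diff_nat_numeral nat_numeral nat_0 nat_one_as_int[symmetric] pred_numeral_def[symmetric] pred_numeral_simps
  upt_rec_numeral Suc_numeral list.pred_inject

text \<open>The case \<open>m = 1\<close> is separate because \<open>upt_rec_numeral\<close> unfolds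
  only lists that start at a numeral, and \<open>1\<close> is not one.\<close>

lemma scan_1: "scan 3 5 0 2"
  by (simp only: scan.simps eval_rules cong: if_weak_cong)

text \<open>\<open>245\<close> is the least \<open>m\<close> with \<open>733 \<le> 3 * m\<close>,
  where a window meets every residue class.\<close>

lemma scan_less_245: "list_all (\<lambda>m. scan (3 * m) (5 * m) 0 (3 * m - 1)) [2..<245]"
  by (simp only: scan.simps eval_rules cong: if_weak_cong)

lemma prime_733: "prime (733 :: nat)"
  unfolding prime_divisor_sqrt
proof (intro conjI allI impI)
  fix d :: nat
  assume d: "d dvd 733 \<and> d\<^sup>2 \<le> 733"
  have "\<not> 28 \<le> d"
  proof
    assume "28 \<le> d"
    then have "28\<^sup>2 \<le> d\<^sup>2" by (rule power_mono) simp
    then show False using d by simp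
  qed
  moreover have "list_all (\<lambda>d. \<not> d dvd (733 :: nat)) [2..<28]" by simp
  then have "\<forall>d \<in> {2..<28}. \<not> d dvd (733 :: nat)"
    unfolding list_all_iff set_upt .
  ultimately have "\<not> 2 \<le> d"
    using d by (metis atLeastLessThan_iff not_le)
  moreover have "d \<noteq> 0" using d by (cases d) simp_all
  ultimately show "d = 1" by linarith
qed simp

lemma block_mismatch:
  assumes "0 < m" "\<not> 733 dvd m"
  shows "\<exists>k < 3 * m. block (i + k) \<noteq> block (i + k + 5 * m)"
proof (cases "m < 245")
  case True
  have "scan (3 * m) (5 * m) 0 (3 * m - 1)"
  proof (cases "m = 1")
    case True
    then show ?thesis using scan_1 by simp
  next
    case False
    then have "m \<in> set [2..<245]"
      using assms(1) \<open>m < 245\<close> unfolding set_upt atLeastLessThan_iff by linarith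
    then show ?thesis using scan_less_245 unfolding list_all_iff by blast
  qed
  from scan_sound[OF this, of "i mod 733"] assms(1)
  obtain q where q: "i mod 733 \<le> q" "q < i mod 733 + 3 * m" "block q \<noteq> block (q + 5 * m)"
    by auto
  define k where "k = q - i mod 733"
  have "[q = i + k] (mod 733)"
    using q(1) unfolding k_def cong_def by (metis le_add_diff_inverse mod_add_left_eq)
  then have "block q = block (i + k)" "block (q + 5 * m) = block (i + k + 5 * m)"
    by (auto intro!: block_cong cong_add)
  moreover have "k < 3 * m" using q(1,2) unfolding k_def by linarith
  ultimately show ?thesis using q(3) by auto
next
  case False
  show ?thesis
  proof (rule ccontr)
    assume "\<not> ?thesis"
    then have eq: "block (i + k) = block (i + k + 5 * m)" if "k < 3 * m" for k
      using that by blast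
    have period: "block p = block (p + 5 * m)" for p
    proof -
      \<comment> \<open>\<open>732\<close> is \<open>-1\<close> modulo \<open>733\<close>, so
        \<open>k\<close> represents \<open>p - i\<close>.\<close>
      define k where "k = (p + 732 * i) mod 733"
      have "[i + k = i + (p + 732 * i)] (mod 733)"
        unfolding k_def cong_def by (simp add: mod_add_right_eq)
      moreover have "[i + (p + 732 * i) = p] (mod 733)"
        by (simp add: cong_def algebra_simps)
      ultimately have c: "[i + k = p] (mod 733)" by (rule cong_trans)
      have "k < 733" by (simp add: k_def)
      with False have "block (i + k) = block (i + k + 5 * m)" by (intro eq) simp
      moreover have "block (i + k) = block p" "block (i + k + 5 * m) = block (p + 5 * m)"
        using c by (auto intro!: block_cong cong_add)
      ultimately show ?thesis by simp
    qed
    have multiple: "block 0 = block (5 * m * t)" for t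
    proof (induction t)
      case (Suc t)
      then show ?case using period[of "5 * m * t"] by (simp add: add.commute)
    qed simp
    have "\<not> 733 dvd 5 * m"
      using assms(2) prime_dvd_mult_iff[OF prime_733, of 5 m] by auto
    then have "coprime (5 * m) 733"
      using prime_imp_coprime[OF prime_733] coprime_commute by blast
    then obtain t where t: "[5 * m * t = Suc 0] (mod 733)"
      using cong_solve_coprime_nat by blast
    \<comment> \<open>Multiples of the period reach every residue, in particular \<open>732\<close>,
      whose letter \<open>2\<close> differs from \<open>block 0 = 0\<close>.\<close>
    have "[5 * m * (t * 732) = 732] (mod 733)"
      using cong_mult[OF t cong_refl[of 732]] by (simp add: mult.assoc mult.left_commute)
    then have "block 0 = block 732" using multiple block_cong by metis
    then show False by simp
  qed
qed

section \<open>Lowering a letter of the block\<close>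

fun agree :: "nat \<Rightarrow> nat \<Rightarrow> nat \<Rightarrow> bool" where
  "agree d p n =
     (if n = 0 then True
      else if block p = block (p - d) then agree d (p - 1) (n - 1) else False)"

declare agree.simps [simp del]

lemma agree_sound: "agree d p n \<Longrightarrow> k < n \<Longrightarrow> block (p - k) = block (p - k - d)"
proof (induction d p n arbitrary: k rule: agree.induct)
  case (1 d p n)
  then have *: "n \<noteq> 0" "block p = block (p - d)" "agree d (p - 1) (n - 1)"
    by (auto simp: agree.simps[of d p n] split: if_splits)
  show ?case
  proof (cases k)
    case 0
    then show ?thesis using * by simp
  next
    case (Suc k')
    then show ?thesis using "1.IH"[of k'] "1.prems" * by simp
  qed
qed

text \<open>\<open>search r c m\<close> looks for a power ending at position \<open>r\<close> of \<open>block(r := c)\<close>, trying the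
  lengths \<open>8m, 8(m + 1), \<dots>\<close> up to \<open>r + 1\<close>.\<close>

function search :: "nat \<Rightarrow> nat \<Rightarrow> nat \<Rightarrow> bool" where
  "search r c m =
     (if r + 1 < 8 * m then False
      else if c = block (r - 5 * m)
        then (if agree (5 * m) (r - 1) (3 * m - 1) then True else search r c (m + 1))
      else search r c (m + 1))"
  by auto
termination
  by (relation "measure (\<lambda>(r, c, m). Suc r - m)") auto

declare search.simps [simp del]

lemma search_sound:
  assumes "search r c m" "0 < m"
  shows "\<exists>n>0. \<exists>i. i + 8 * n = Suc r \<and> power_at 8 5 (block(r := c)) i n"
  using assms
proof (induction r c m rule: search.induct)
  case (1 r c m)
  have le: "8 * m \<le> Suc r"
    using "1.prems" by (auto simp: search.simps[of r c m] split: if_splits)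
  show ?case
  proof (cases "c = block (r - 5 * m) \<and> agree (5 * m) (r - 1) (3 * m - 1)")
    case True
    have "power_at 8 5 (block(r := c)) (Suc r - 8 * m) m" unfolding power_at_def
    proof (intro allI impI)
      fix k
      assume "k < (8 - 5) * m"
      then have k: "k < 3 * m" by simp
      let ?x = "block(r := c)" and ?i = "Suc r - 8 * m"
      have ne: "?i + k \<noteq> r" using k le "1.prems"(2) by linarith
      show "?x (?i + k) = ?x (?i + k + 5 * m)"
      \<comment> \<open>Only the last comparison meets the new letter \<open>c\<close>;
        \<open>agree\<close> covers the other \<open>3 * m - 1\<close>, counted backwards from
        \<open>r - 1\<close>.\<close>
      proof (cases "k = 3 * m - 1")
        case last: True
        have "?i + k + 5 * m = r" "?i + k = r - 5 * m"
          using last le "1.prems"(2) by linarith+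
        then show ?thesis using True ne by auto
      next
        case False
        define l where "l = 3 * m - 2 - k"
        have l: "l < 3 * m - 1" "r - 1 - l = ?i + k + 5 * m" "r - 1 - l - 5 * m = ?i + k"
          "?i + k + 5 * m \<noteq> r"
          using False k le "1.prems"(2) by (simp_all add: l_def)
        show ?thesis using agree_sound[OF conjunct2[OF True] l(1), unfolded l(2,3)] l(4) ne by simp
      qed
    qed
    moreover have "Suc r - 8 * m + 8 * m = Suc r" using le by simp
    ultimately show ?thesis using "1.prems"(2) by blast
  next
    case False
    then have "search r c (m + 1)"
      using "1.prems"(1) le by (auto simp: search.simps[of r c m] split: if_splits)
    then show ?thesis
      using "1.IH" False le by (cases "c = block (r - 5 * m)") auto
  qed
qed

text \<open>Nested conditionals instead of \<open>\<forall>c < block r. search r c 1\<close>, so that the simplifier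
  evaluates a search only where it is needed.\<close>

definition lowerable :: "nat \<Rightarrow> bool" where
  "lowerable r \<longleftrightarrow>
     (if block r = 0 then True
      else if search r 0 1 then (if block r = 1 then True else search r 1 1) else False)"

text \<open>The letters at \<open>0\<close> and \<open>1\<close> are already \<open>0\<close>, so
  the range can start at the numeral \<open>2\<close>.\<close>

lemma list_all_lowerable: "list_all lowerable [2..<733]"
  by (simp only: lowerable_def search.simps agree.simps eval_rules cong: if_weak_cong)

lemma block_lowered:
  assumes "r < 733" "c < block r"
  shows "\<exists>m>0. \<exists>i. i + 8 * m = Suc r \<and> power_at 8 5 (block(r := c)) i m"
proof (rule search_sound[of r c 1])
  have "r \<noteq> 0 \<and> r \<noteq> 1"
    using assms(2) by (intro conjI notI) simp_all
  then have "r \<in> set [2..<733]"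
    using assms(1) unfolding set_upt atLeastLessThan_iff by linarith
  then have "lowerable r" using list_all_lowerable unfolding list_all_iff by blast
  moreover have "c = 0 \<or> c = 1 \<and> block r \<noteq> 1"
    using assms(2) block_le_2[of r] by linarith
  ultimately show "search r c 1"
    using assms(2) unfolding lowerable_def by (auto split: if_splits)
qed simp

section \<open>The fixed point\<close>

definition w :: "nat word" where
  "w = morphism_fixed_point \<phi> 0"

lemma is_morphism_image_uniform_nth:
  assumes "uniform_morphism k f" "is_morphism_image f x y" "r < k"
  shows "y (k * j + r) = f (x j) ! r"
proof -
  have len: "length (morphism_word f v) = k * length v" for v
    using assms(1) by (induction v) (simp_all add: morphism_word_def uniform_morphism_def)
  have "(x [0 \<rightarrow> Suc j]) = (x [0 \<rightarrow> j]) @ [x j]"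
    by (simp add: subsequence_def)
  then have "morphism_word f (x [0 \<rightarrow> Suc j]) = morphism_word f (x [0 \<rightarrow> j]) @ f (x j)"
    by (simp add: morphism_word_def)
  moreover have "y [0 \<rightarrow> k * Suc j] = morphism_word f (x [0 \<rightarrow> Suc j])"
    using assms(2) len[of "x [0 \<rightarrow> Suc j]"] unfolding is_morphism_image_def
    by (metis subsequence_length diff_zero)
  ultimately have "y [0 \<rightarrow> k * Suc j] ! (k * j + r) = f (x j) ! r"
    using len[of "x [0 \<rightarrow> j]"] by (simp add: nth_append)
  then show ?thesis using assms(3) by simp
qed

lemma w_nth: "r < 733 \<Longrightarrow> w (733 * j + r) = \<phi> (w j) ! r"
  using theI'[OF ex1_fixed_point[OF uniform_\<phi> _ hd_\<phi>]]
  by (intro is_morphism_image_uniform_nth[OF uniform_\<phi>])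
    (simp_all add: w_def morphism_fixed_point_def)

lemma w_last: "w (733 * j + 732) = w j + 2"
  by (simp add: w_nth \<phi>_def nth_append length_u)

lemma w_block: "r < 732 \<Longrightarrow> w (733 * j + r) = block r"
  by (simp add: w_nth block_def \<phi>_def nth_append length_u)

text \<open>A letter \<open>n + 2\<close> at the end of an image equals a letter of \<open>u\<close> only if \<open>n = 0\<close>.\<close>

lemma w_eq_imp_block_eq:
  assumes "w p = w q" "p mod 733 \<noteq> q mod 733"
  shows "block p = block q"
proof -
  have last: "block p = 2 \<and> block q = 2"
    if "p mod 733 = 732" "q mod 733 \<noteq> 732" "w p = w q" for p q
  proof -
    have "q mod 733 < 732" using that(2) mod_less_divisor[of 733 q] by linarith
    then have "w q = block q"
      using w_block[of "q mod 733" "q div 733"] by (simp add: block_mod)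
    moreover have "w p = w (p div 733) + 2"
      using w_last[of "p div 733"] that(1) by (metis mult_div_mod_eq)
    moreover have "block p = 2"
      using that(1) block_mod[of p] by simp
    ultimately show ?thesis using that(3) block_le_2[of q] by simp
  qed
  have "w p = block p" if "p mod 733 \<noteq> 732" for p
  proof -
    have "p mod 733 < 732" using that mod_less_divisor[of 733 p] by linarith
    then show ?thesis using w_block[of "p mod 733" "p div 733"] by (simp add: block_mod)
  qed
  then show ?thesis using last[of p q] last[of q p] assms by metis
qed

section \<open>Freeness of \<open>w\<close>\<close>

lemma power_at_w_contract:
  assumes "power_at 8 5 w i (733 * m)"
  shows "power_at 8 5 w (i div 733) m"
  unfolding power_at_def
proof (intro allI impI)
  fix k
  assume "k < (8 - 5) * m"
  then have k: "k < 3 * m" by simp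
  define j r where "j = i div 733" and "r = i mod 733"
  have i: "i = 733 * j + r" "r < 733" by (simp_all add: j_def r_def)
  \<comment> \<open>\<open>i + l\<close> is the position of the last letter of the image of
    \<open>w (j + k)\<close>.\<close>
  define l where "l = 733 * k + (732 - r)"
  have "l < 3 * (733 * m)" using k unfolding l_def by linarith
  then have "w (i + l) = w (i + l + 5 * (733 * m))"
    using assms by (simp add: power_at_def)
  moreover have "i + l = 733 * (j + k) + 732"
    using i unfolding l_def by (simp add: distrib_left)
  moreover from this have "i + l + 5 * (733 * m) = 733 * (j + k + 5 * m) + 732"
    by simp
  ultimately have "w (733 * (j + k) + 732) = w (733 * (j + k + 5 * m) + 732)"
    by (simp only:)
  then show "w (i div 733 + k) = w (i div 733 + k + 5 * m)"
    using w_last[of "j + k"] w_last[of "j + k + 5 * m"] unfolding j_def by (simp del: distrib_left_numeral)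
qed

lemma not_power_at_w: "0 < m \<Longrightarrow> \<not> power_at 8 5 w i m"
proof (induction m arbitrary: i rule: less_induct)
  case (less m)
  show ?case
  proof (cases "733 dvd m")
    case True
    then obtain n where n: "m = 733 * n" by (elim dvdE)
    then show ?thesis
      using less.IH[of n] less.prems power_at_w_contract[of i n] by auto
  next
    case False
    then obtain k where k: "k < 3 * m" "block (i + k) \<noteq> block (i + k + 5 * m)"
      using block_mismatch less.prems by blast
    have "\<not> 733 dvd 5 * m"
      using False prime_dvd_mult_iff[OF prime_733, of 5 m] by auto
    then have "(i + k) mod 733 \<noteq> (i + k + 5 * m) mod 733"
      by (metis add_diff_cancel_left' le_add1 mod_eq_dvd_iff_nat)
    then have "w (i + k) \<noteq> w (i + k + 5 * m)"
      using w_eq_imp_block_eq k(2) by blast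
    then show ?thesis using k(1) unfolding power_at_def by auto
  qed
qed

section \<open>Minimality of \<open>w\<close>\<close>

lemma w_lowered_in_block:
  assumes "r < 733" "c < block r"
  shows "\<exists>m>0. \<exists>i. i + 8 * m = Suc (733 * j + r) \<and> power_at 8 5 (w(733 * j + r := c)) i m"
proof -
  obtain m i where m: "m > 0" "i + 8 * m = Suc r" "power_at 8 5 (block(r := c)) i m"
    using block_lowered[OF assms] by blast
  \<comment> \<open>The image and the block can differ only at \<open>s = 732\<close>; then
    \<open>s = r\<close>, and that letter is replaced by \<open>c\<close> in both.\<close>
  have eq: "(w(733 * j + r := c)) (733 * j + s) = (block(r := c)) s" if "s \<le> r" for s
    using that assms(1) w_block[of s j] by auto
  have "power_at 8 5 (w(733 * j + r := c)) (733 * j + i) m"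
    unfolding power_at_def
  proof (intro allI impI)
    fix k
    assume k: "k < (8 - 5) * m"
    then have "i + k \<le> r" "i + k + 5 * m \<le> r" using m(2) by auto
    then show "(w(733 * j + r := c)) (733 * j + i + k) =
        (w(733 * j + r := c)) (733 * j + i + k + 5 * m)"
      using m(3) k eq[of "i + k"] eq[of "i + k + 5 * m"]
      by (simp add: power_at_def add.assoc)
  qed
  moreover have "733 * j + i + 8 * m = Suc (733 * j + r)" using m(2) by simp
  ultimately show ?thesis using m(1) by blast
qed

text \<open>The changed word is the image under \<open>\<phi>\<close> of \<open>w(j := c)\<close>,
  and a uniform morphism maps powers to powers.\<close>

lemma power_at_w_expand:
  assumes "power_at 8 5 (w(j := c)) i m" "i + 8 * m = Suc j" "m > 0"
  shows "power_at 8 5 (w(733 * j + 732 := c + 2)) (733 * i) (733 * m)"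
  unfolding power_at_def
proof (intro allI impI)
  fix l
  assume "l < (8 - 5) * (733 * m)"
  then have l: "l div 733 < 3 * m" by (simp add: less_mult_imp_div_less mult.commute)
  define k r where "k = l div 733" and "r = l mod 733"
  have lkr: "l = 733 * k + r" "r < 733" by (simp_all add: k_def r_def)
  let ?x = "w(733 * j + 732 := c + 2)"
  have x: "?x (733 * s + r) = (if r = 732 then (w(j := c)) s + 2 else block r)" for s
  proof (cases "r = 732")
    case True
    then show ?thesis using w_last[of s] by simp
  next
    case False
    moreover have "(733 * s + r) mod 733 = r" "(733 * j + 732) mod 733 = 732"
      using lkr(2) by simp_all
    ultimately have "733 * s + r \<noteq> 733 * j + 732" by metis
    then show ?thesis using False lkr(2) w_block[of r s] by simp
  qed
  have "733 * i + l = 733 * (i + k) + r"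
    "733 * i + l + 5 * (733 * m) = 733 * (i + k + 5 * m) + r"
    by (simp_all add: lkr(1) algebra_simps)
  moreover have "(w(j := c)) (i + k) = (w(j := c)) (i + k + 5 * m)"
    using assms(1) l by (simp add: power_at_def k_def)
  ultimately show "?x (733 * i + l) = ?x (733 * i + l + 5 * (733 * m))"
    by (simp only: x)
qed

lemma w_lowered:
  "c < w n \<Longrightarrow> \<exists>m>0. \<exists>i. i + 8 * m = Suc n \<and> power_at 8 5 (w(n := c)) i m"
proof (induction n arbitrary: c rule: less_induct)
  case (less n)
  define j r where "j = n div 733" and "r = n mod 733"
  have n: "n = 733 * j + r" "r < 733" by (simp_all add: j_def r_def)
  show ?case
  proof (cases "c < block r")
    case True
    then show ?thesis using w_lowered_in_block[OF n(2)] unfolding n(1) by blast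
  next
    case False
    have r: "r = 732"
    proof (rule ccontr)
      assume "r \<noteq> 732"
      then show False using False less.prems n w_block[of r j] by simp
    qed
    \<comment> \<open>As \<open>block 732 = 2\<close>, lowering \<open>w n\<close> to
      \<open>c = c' + 2\<close> amounts to lowering \<open>w j\<close> to \<open>c'\<close> before
      applying \<open>\<phi>\<close>.\<close>
    then have "2 \<le> c" using False by simp
    then obtain c' where c': "c = c' + 2" using le_Suc_ex by (metis add.commute)
    have "c' < w j" using less.prems n(1) r w_last[of j] c' by simp
    moreover have "j < n" using n(1) r by simp
    ultimately obtain m i where m: "m > 0" "i + 8 * m = Suc j" "power_at 8 5 (w(j := c')) i m"
      using less.IH by blast
    have "power_at 8 5 (w(n := c)) (733 * i) (733 * m)"
      using power_at_w_expand[OF m(3,2,1)] n(1) r c' by simp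
    moreover have "733 * i + 8 * (733 * m) = Suc n" using m(2) n(1) r by simp
    moreover have "733 * m > 0" using m(1) by simp
    ultimately show ?thesis by blast
  qed
qed

theorem theorem2p3:
  shows "lex_least_power_free 8 5 = morphism_fixed_point \<phi> 0"
proof -
  have "is_lex_least_power_free 8 5 w"
    using not_power_at_w w_lowered
    by (intro is_lex_least_power_freeI) (auto simp: power_free_iff_power_at)
  then have "lex_least_power_free 8 5 = w"
    unfolding lex_least_power_free_def
    by (intro the1_equality ex1_lex_least_power_free) auto
  then show ?thesis by (simp add: w_def)
qed

end
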